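(* Let $P$ and $Q$ be probability distributions on a measurable space $(\mathcal{X},\mathcal{F})$. The Rényi divergence $D_\alpha(P\|Q)$ is continuous in $\alpha$ (as a $[0,\infty]$-valued function) on $$\mathcal{A}=\{\alpha\in[0,\infty]\mid 0\le\alpha\le1\text{ or }D_\alpha(P\|Q)<\infty\}.$$
   Context: Rényi divergence: let $P,Q$ have densities $p,q$ with respect to a dominating $\sigma$-finite measure $\mu$ (whose choice is immaterial). For $\alpha\in(0,1)\cup(1,\infty)$, $D_\alpha(P\|Q)=\frac{1}{\alpha-1}\ln\int p^\alpha q^{1-\alpha}\,d\mu\in[0,\infty]$, where for $\alpha>1$ one reads $p^\alpha q^{1-\alpha}$ as $p^\alpha/q^{\alpha-1}$ with the conventions $0/0=0$ and $x/0=\infty$ for $x>0$. Further $D_0(P\|Q)=\lim_{\alpha\downarrow0}D_\alpha(P\|Q)$, $D_1(P\|Q)=\lim_{\alpha\uparrow1}D_\alpha(P\|Q)$ and $D_\infty(P\|Q)=\lim_{\alpha\uparrow\infty}D_\alpha(P\|Q)$ (these limits always exist in $[0,\infty]$). *)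

theory Defs
  imports "HOL-Probability.Probability"
begin

definition ln_ennreal :: "ennreal \<Rightarrow> ereal" where
  "ln_ennreal x = (if x = 0 then -\<infinity> else if x = \<infinity> then \<infinity> else ereal (ln (enn2real x)))"

text \<open>The integrand \<open>p\<^sup>a q\<^sup>1\<^sup>-\<^sup>a\<close> of the Renyi divergence of finite order \<open>a\<close>. Division on
  \<^typ>\<open>ennreal\<close> satisfies \<open>0 / 0 = 0\<close> and \<open>x / 0 = \<infinity>\<close> for \<open>x > 0\<close>, as required in the case
  \<open>a > 1\<close>. The densities are finite almost everywhere, so the values of the
  integrand at infinite arguments do not matter.\<close>

definition renyi_integrand :: "real \<Rightarrow> ennreal \<Rightarrow> ennreal \<Rightarrow> ennreal" where
  "renyi_integrand a p q =
     (if a < 1 then ennreal (enn2real p powr a * enn2real q powr (1 - a))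
      else ennreal (enn2real p powr a) / ennreal (enn2real q powr (a - 1)))"

definition sum_measure :: "'a measure \<Rightarrow> 'a measure \<Rightarrow> 'a measure" where
  "sum_measure P Q = measure_of (space P) (sets P) (\<lambda>A. emeasure P A + emeasure Q A)"

text \<open>The dominating measure is taken to be \<open>P + Q\<close>; lemma \<open>renyi_integral_eq\<close> below shows
  that any other sigma-finite dominating measure, and any choice of densities, gives the
  same value.\<close>

definition renyi_integral :: "real \<Rightarrow> 'a measure \<Rightarrow> 'a measure \<Rightarrow> ennreal" where
  "renyi_integral a P Q =
     (\<integral>\<^sup>+x. renyi_integrand a (RN_deriv (sum_measure P Q) P x) (RN_deriv (sum_measure P Q) Q x)
        \<partial>sum_measure P Q)"

definition renyi_divergence_simple :: "real \<Rightarrow> 'a measure \<Rightarrow> 'a measure \<Rightarrow> ereal" where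
  "renyi_divergence_simple a P Q = ereal (1 / (a - 1)) * ln_ennreal (renyi_integral a P Q)"

text \<open>Only orders in \<open>[0, \<infinity>]\<close> are meaningful. Values are in \<^typ>\<open>ereal\<close> rather than
  \<^typ>\<open>ennreal\<close> so that nonnegativity is not forced by truncation.\<close>

definition renyi_divergence :: "ereal \<Rightarrow> 'a measure \<Rightarrow> 'a measure \<Rightarrow> ereal" where
  "renyi_divergence \<alpha> P Q =
     (if \<alpha> = 0 then Lim (at_right 0) (\<lambda>a. renyi_divergence_simple a P Q)
      else if \<alpha> = 1 then Lim (at_left 1) (\<lambda>a. renyi_divergence_simple a P Q)
      else if \<alpha> = \<infinity> then Lim at_top (\<lambda>a. renyi_divergence_simple a P Q)
      else renyi_divergence_simple (real_of_ereal \<alpha>) P Q)"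

lemma space_sum_measure [simp]: "space (sum_measure P Q) = space P"
  and sets_sum_measure [simp, measurable_cong]: "sets (sum_measure P Q) = sets P"
  by (simp_all add: sum_measure_def)

lemma emeasure_sum_measure:
  assumes "sets Q = sets P" "A \<in> sets P"
  shows "emeasure (sum_measure P Q) A = emeasure P A + emeasure Q A"
proof (rule emeasure_measure_of[OF sum_measure_def])
  show "sets P \<subseteq> Pow (space P)" by (rule sets.space_closed)
  show "A \<in> sets (sum_measure P Q)" using assms by simp
  show "positive (sets (sum_measure P Q)) (\<lambda>A. emeasure P A + emeasure Q A)"
    by (simp add: positive_def)
  show "countably_additive (sets (sum_measure P Q)) (\<lambda>A. emeasure P A + emeasure Q A)"
    using assms(1)
    by (auto simp: countably_additive_def suminf_add[symmetric] suminf_emeasure)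
qed

lemma finite_measure_sum_measure:
  assumes "finite_measure P" "finite_measure Q" "sets Q = sets P"
  shows "finite_measure (sum_measure P Q)"
proof
  have "space P \<in> sets Q" "space P \<in> sets P" using assms(3) by auto
  then show "emeasure (sum_measure P Q) (space (sum_measure P Q)) \<noteq> \<infinity>"
    using assms by (simp add: emeasure_sum_measure finite_measure.emeasure_finite)
qed

lemma absolutely_continuous_sum_measure:
  assumes "sets Q = sets P"
  shows "absolutely_continuous (sum_measure P Q) P" "absolutely_continuous (sum_measure P Q) Q"
  using assms by (auto simp: absolutely_continuous_def null_sets_def emeasure_sum_measure)

lemma sum_measure_density:
  assumes [measurable]: "p \<in> borel_measurable M" "q \<in> borel_measurable M"
  shows "sum_measure (density M p) (density M q) = density M (\<lambda>x. p x + q x)"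
proof (rule measure_eqI)
  fix A assume "A \<in> sets (sum_measure (density M p) (density M q))"
  then have [measurable]: "A \<in> sets M" by simp
  show "emeasure (sum_measure (density M p) (density M q)) A = emeasure (density M (\<lambda>x. p x + q x)) A"
    by (simp add: emeasure_sum_measure emeasure_density nn_integral_add[symmetric] distrib_right)
qed simp

lemma renyi_integrand_scale:
  assumes "0 < a" "a \<noteq> 1" "h \<noteq> \<infinity>" "h = 0 \<or> (p \<noteq> \<infinity> \<and> q \<noteq> \<infinity>)"
  shows "renyi_integrand a (h * p) (h * q) = h * renyi_integrand a p q"
proof (cases "h = 0")
  case True
  then show ?thesis using assms by (simp add: renyi_integrand_def)
next
  case False
  obtain r where r: "h = ennreal r" "0 < r"
    using assms(3) False by (cases h) (auto simp: less_le)
  obtain s where s: "p = ennreal s" "0 \<le> s" using assms(4) False by (cases p) auto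
  obtain t where t: "q = ennreal t" "0 \<le> t" using assms(4) False by (cases q) auto
  have hp: "enn2real (h * p) = r * s" "enn2real (h * q) = r * t"
    using r s t by (simp_all add: enn2real_mult)
  show ?thesis
  proof (cases "a < 1")
    case True
    have "(r * s) powr a * (r * t) powr (1 - a)
        = (r powr a * r powr (1 - a)) * (s powr a * t powr (1 - a))"
      using r s t by (simp add: powr_mult mult_ac)
    also have "r powr a * r powr (1 - a) = r" using r by (simp flip: powr_add)
    finally show ?thesis using True r s t hp
      by (simp add: renyi_integrand_def ennreal_mult' del: enn2real_mult)
  next
    case a: False
    then have a1: "1 < a" using assms by simp
    show ?thesis
    proof (cases "t = 0")
      case True
      then show ?thesis using a1 r s t hp
        by (cases "s = 0") (auto simp: renyi_integrand_def ennreal_mult_top ennreal_divide_zero)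
    next
      case False
      then have t0: "0 < t" using t by simp
      have "(r * s) powr a / (r * t) powr (a - 1)
          = (r powr a / r powr (a - 1)) * (s powr a / t powr (a - 1))"
        using r s t by (simp add: powr_mult)
      also have "r powr a / r powr (a - 1) = r" using r by (simp flip: powr_diff)
      finally have eq: "(r * s) powr a / (r * t) powr (a - 1) = r * (s powr a / t powr (a - 1))" .
      have "renyi_integrand a (h * p) (h * q) = ennreal ((r * s) powr a / (r * t) powr (a - 1))"
        using a r t0 unfolding renyi_integrand_def hp by (simp add: divide_ennreal)
      also have "\<dots> = h * ennreal (s powr a / t powr (a - 1))"
        unfolding eq r(1) using r(2) by (intro ennreal_mult) auto
      also have "ennreal (s powr a / t powr (a - 1)) = renyi_integrand a p q"
        using a s t t0 by (simp add: renyi_integrand_def divide_ennreal)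
      finally show ?thesis .
    qed
  qed
qed

lemma renyi_integral_eq:
  assumes "prob_space P" "prob_space Q" "sigma_finite_measure M"
    and [measurable]: "p \<in> borel_measurable M" "q \<in> borel_measurable M"
    and P: "density M p = P" and Q: "density M q = Q"
    and a: "0 < a" "a \<noteq> 1"
  shows "renyi_integral a P Q = (\<integral>\<^sup>+x. renyi_integrand a (p x) (q x) \<partial>M)"
proof -
  interpret M: sigma_finite_measure M by fact
  interpret P: prob_space P by fact
  interpret Q: prob_space Q by fact
  have sets_P [measurable_cong, simp]: "sets P = sets M" and sets_Q [measurable_cong, simp]: "sets Q = sets M"
    using P Q by auto
  define N where "N = sum_measure P Q"
  interpret N: finite_measure N
    unfolding N_def by (intro finite_measure_sum_measure P.finite_measure_axioms Q.finite_measure_axioms) simp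
  have N: "N = density M (\<lambda>x. p x + q x)"
    unfolding N_def P[symmetric] Q[symmetric] by (rule sum_measure_density) auto
  have sets_N [measurable_cong, simp]: "sets N = sets M" by (simp add: N_def)
  have ac: "absolutely_continuous N P" "absolutely_continuous N Q"
    unfolding N_def by (auto intro: absolutely_continuous_sum_measure)
  define p' where "p' = RN_deriv N P"
  define q' where "q' = RN_deriv N Q"
  have [measurable]: "p' \<in> borel_measurable M" "q' \<in> borel_measurable M"
    using borel_measurable_RN_deriv[of N P] borel_measurable_RN_deriv[of N Q]
    by (simp_all add: p'_def q'_def cong: measurable_cong_sets)
  have dP: "density N p' = P" and dQ: "density N q' = Q"
    unfolding p'_def q'_def by (auto intro!: N.density_RN_deriv ac)
  have "AE x in N. p' x \<noteq> \<infinity>" "AE x in N. q' x \<noteq> \<infinity>"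
    unfolding p'_def q'_def
    by (intro N.RN_deriv_finite ac P.sigma_finite_measure_axioms Q.sigma_finite_measure_axioms; simp)+
  then have fin': "AE x in M. 0 < p x + q x \<longrightarrow> p' x \<noteq> \<infinity>" "AE x in M. 0 < p x + q x \<longrightarrow> q' x \<noteq> \<infinity>"
    unfolding N by (simp_all add: AE_density)
  have "density M p = density M (\<lambda>x. (p x + q x) * p' x)"
    using dP P N by (simp add: density_density_eq)
  then have eqp: "AE x in M. p x = (p x + q x) * p' x"
    by (intro M.density_unique) auto
  have "density M q = density M (\<lambda>x. (p x + q x) * q' x)"
    using dQ Q N by (simp add: density_density_eq)
  then have eqq: "AE x in M. q x = (p x + q x) * q' x"
    by (intro M.density_unique) auto
  have "sigma_finite_measure (density M (\<lambda>x. p x + q x))"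
    using N N.sigma_finite_measure_axioms by simp
  then have finh: "AE x in M. p x + q x \<noteq> \<infinity>"
    by (subst (asm) M.sigma_finite_iff_density_finite) auto
  have [measurable]: "(\<lambda>x. renyi_integrand a (p' x) (q' x)) \<in> borel_measurable M"
    unfolding renyi_integrand_def by measurable
  have "renyi_integral a P Q = (\<integral>\<^sup>+x. renyi_integrand a (p' x) (q' x) \<partial>N)"
    by (simp add: renyi_integral_def p'_def q'_def N_def)
  also have "\<dots> = (\<integral>\<^sup>+x. (p x + q x) * renyi_integrand a (p' x) (q' x) \<partial>M)"
    unfolding N by (subst nn_integral_density) auto
  also have "\<dots> = (\<integral>\<^sup>+x. renyi_integrand a (p x) (q x) \<partial>M)"
  proof (rule nn_integral_cong_AE)
    show "AE x in M. (p x + q x) * renyi_integrand a (p' x) (q' x) = renyi_integrand a (p x) (q x)"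
      using eqp eqq finh fin'
    proof eventually_elim
      case (elim x)
      have "renyi_integrand a ((p x + q x) * p' x) ((p x + q x) * q' x)
          = (p x + q x) * renyi_integrand a (p' x) (q' x)"
        using elim(3-5) by (intro renyi_integrand_scale a) (auto simp: zero_less_iff_neq_zero)
      then show ?case using elim(1,2) by simp
    qed
  qed
  finally show ?thesis .
qed

end

theory Submission
  imports Defs
begin

text \<open>Write \<open>J a\<close> for the integral of \<open>p\<^sup>a q\<^sup>1\<^sup>-\<^sup>a\<close>. The bound
  \<open>p\<^sup>a q\<^sup>1\<^sup>-\<^sup>a \<le> q + p\<^sup>c q\<^sup>1\<^sup>-\<^sup>c\<close> for \<open>0 \<le> a \<le> c\<close> and dominated convergence make \<open>J\<close>
  continuous wherever it is finite, which settles the orders other than \<open>0\<close>, \<open>1\<close> and \<open>\<infinity>\<close>.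
  Log-convexity of \<open>J\<close> together with \<open>J 1 \<le> 1\<close> makes the divergence monotone on \<open>(0, 1)\<close> and on
  \<open>(1, \<infinity>)\<close>, so the limits defining the three exceptional orders exist. This leaves continuity at
  \<open>1\<close> from the right, which matters only if \<open>J c < \<infinity>\<close> for some \<open>c > 1\<close>. Then \<open>P\<close> is absolutely
  continuous with respect to \<open>Q\<close> and \<open>J 1 = 1\<close>. The integrand is convex in \<open>a\<close>, so its difference
  quotients at \<open>1\<close> are dominated; hence \<open>J\<close> is differentiable at \<open>1\<close>, and
  \<open>ln (J a) / (a - 1)\<close> has the same limit from both sides.\<close>

section \<open>Transfer of limits and dominated convergence\<close>

lemma tendsto_ereal_within:
  assumes "((\<lambda>t. f (ereal t)) \<longlongrightarrow> l) (at a within {t. ereal t \<in> A})"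
  shows "(f \<longlongrightarrow> l) (at (ereal a) within A)"
  using assms by (simp add: tendsto_def eventually_at_filter nhds_ereal eventually_filtermap)

text \<open>Dominated convergence concerns sequences; first countability lets sequences in
  \<open>S\<close> that avoid \<open>b\<close> test the limit. Restricting to \<open>S\<close>
  covers one-sided limits as well.\<close>

lemma tendsto_integral_within:
  fixes f :: "'b::{first_countable_topology, t1_space} \<Rightarrow> 'a \<Rightarrow> real"
  assumes meas: "\<And>t. t \<in> S \<Longrightarrow> f t \<in> borel_measurable M" "g \<in> borel_measurable M"
    and w: "integrable M w"
    and lim: "AE x in M. ((\<lambda>t. f t x) \<longlongrightarrow> g x) (at b within S)"
    and bound: "\<And>t x. t \<in> S \<Longrightarrow> t \<noteq> b \<Longrightarrow> norm (f t x) \<le> w x"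
  shows "((\<lambda>t. \<integral>x. f t x \<partial>M) \<longlongrightarrow> (\<integral>x. g x \<partial>M)) (at b within S)"
  unfolding tendsto_at_iff_sequentially
proof (intro allI impI)
  fix X assume X: "\<forall>i. X i \<in> S - {b}" and "X \<longlonglongrightarrow> b"
  have "(\<lambda>i. \<integral>x. f (X i) x \<partial>M) \<longlonglongrightarrow> (\<integral>x. g x \<partial>M)"
  proof (rule integral_dominated_convergence[where w=w])
    show "f (X i) \<in> borel_measurable M" for i using meas X by auto
    show "AE x in M. norm (f (X i) x) \<le> w x" for i using bound X by auto
    show "AE x in M. (\<lambda>i. f (X i) x) \<longlonglongrightarrow> g x"
      using lim by eventually_elim (use X \<open>X \<longlonglongrightarrow> b\<close> in \<open>auto simp: tendsto_at_iff_sequentially comp_def\<close>)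
  qed (use meas w in auto)
  then show "((\<lambda>t. \<integral>x. f t x \<partial>M) \<circ> X) \<longlonglongrightarrow> (\<integral>x. g x \<partial>M)" by (simp add: comp_def)
qed

section \<open>The integrand as a function of the order\<close>

text \<open>Since \<open>0 powr y = 0\<close> for every \<open>y\<close> (even \<open>y = 0\<close>), this vanishes whenever \<open>u = 0\<close> or
  \<open>v = 0\<close>. For \<open>v = 0 < u\<close> and \<open>a > 1\<close> it differs from the integrand of the divergence, which
  is \<open>\<infinity>\<close> there.\<close>

definition geom_interp :: "real \<Rightarrow> real \<Rightarrow> real \<Rightarrow> real" where
  "geom_interp u v a = u powr a * v powr (1 - a)"

lemma geom_interp_nonneg [simp]: "0 \<le> geom_interp u v a"
  by (simp add: geom_interp_def)

lemma geom_interp_eq_0_iff: "geom_interp u v a = 0 \<longleftrightarrow> u = 0 \<or> v = 0"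
  by (simp add: geom_interp_def)

lemma geom_interp_exp:
  assumes "0 < u" "0 < v"
  shows "geom_interp u v a = v * exp (a * ln (u / v))"
  using assms by (simp add: geom_interp_def powr_def ln_div exp_diff exp_add algebra_simps)

text \<open>For positive \<open>u\<close> and \<open>v\<close>, put \<open>l = ln (u / v)\<close>.
  The left side \<open>v * exp (a * l)\<close> is monotone in \<open>a\<close>: for
  \<open>l \<le> 0\<close> it is at most its value \<open>v\<close> at order 0, otherwise at most
  its value at \<open>c\<close>.\<close>

lemma geom_interp_le:
  assumes uv: "0 \<le> u" "0 \<le> v" and a: "0 \<le> a" "a \<le> c"
  shows "geom_interp u v a \<le> v + geom_interp u v c"
proof (cases "u = 0 \<or> v = 0")
  case True
  then have "geom_interp u v a = 0" by (simp add: geom_interp_eq_0_iff)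
  then show ?thesis using uv by simp
next
  case False
  then have pos: "0 < u" "0 < v" using uv by auto
  have "exp (a * ln (u / v)) \<le> 1 + exp (c * ln (u / v))"
  proof (cases "ln (u / v) \<le> 0")
    case True
    then have "exp (a * ln (u / v)) \<le> exp 0"
      using a by (subst exp_le_cancel_iff) (rule mult_nonneg_nonpos)
    then show ?thesis by (smt (verit) exp_zero exp_gt_zero)
  next
    case False
    then have "exp (a * ln (u / v)) \<le> exp (c * ln (u / v))"
      using a by (simp add: mult_right_mono)
    then show ?thesis by (rule order_trans) simp
  qed
  then have "v * exp (a * ln (u / v)) \<le> v * (1 + exp (c * ln (u / v)))"
    using pos by (intro mult_left_mono) auto
  then show ?thesis using pos by (simp add: geom_interp_exp distrib_left)
qed

lemma continuous_geom_interp: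
  assumes "0 \<le> u" "0 \<le> v"
  shows "(geom_interp u v \<longlongrightarrow> geom_interp u v b) (at b within S)"
proof (cases "u = 0 \<or> v = 0")
  case True
  then have "geom_interp u v = (\<lambda>_. 0)" by (intro ext) (simp add: geom_interp_eq_0_iff)
  then show ?thesis by simp
next
  case False
  then show ?thesis unfolding geom_interp_def
    by (intro tendsto_intros) auto
qed

lemma geom_interp_deriv:
  assumes "0 \<le> u" "0 \<le> v"
  shows "(geom_interp u v has_real_derivative geom_interp u v b * ln (u / v)) (at b within S)"
proof (cases "u = 0 \<or> v = 0")
  case True
  then have "geom_interp u v = (\<lambda>_. 0)" by (intro ext) (simp add: geom_interp_eq_0_iff)
  then show ?thesis by simp
next
  case False
  then have pos: "0 < u" "0 < v" using assms by auto
  have eq: "geom_interp u v = (\<lambda>a. v * exp (a * ln (u / v)))"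
    using pos by (intro ext geom_interp_exp)
  show ?thesis unfolding eq
    by (auto intro!: derivative_eq_intros)
qed

text \<open>For positive \<open>u\<close> and \<open>v\<close> the logarithm of
  \<open>geom_interp u v\<close> is affine in the order. If one of them is 0, both sides vanish
  because \<open>0 powr s = 0\<close>.\<close>

lemma geom_interp_geom_interp:
  assumes "0 \<le> u" "0 \<le> v" "s + t = 1"
  shows "geom_interp u v (s * x + t * y) = geom_interp u v x powr s * geom_interp u v y powr t"
proof (cases "u = 0 \<or> v = 0")
  case True
  then have "geom_interp u v z = 0" for z by (simp add: geom_interp_eq_0_iff)
  then show ?thesis by simp
next
  case False
  then have pos: "0 < u" "0 < v" using assms by auto
  have t: "t = 1 - s" using assms by simp
  have "1 - (s * x + t * y) = s * (1 - x) + t * (1 - y)" by (simp add: t algebra_simps)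
  then show ?thesis using pos
    by (simp add: geom_interp_def powr_mult powr_powr powr_add mult_ac)
qed

text \<open>By the preceding identity the value at a convex combination is a weighted geometric
  mean, which Young's inequality bounds by the arithmetic one.\<close>

lemma convex_on_geom_interp:
  assumes "0 \<le> u" "0 \<le> v"
  shows "convex_on UNIV (geom_interp u v)"
proof (rule convex_onI)
  fix t x y :: real assume t: "0 < t" "t < 1"
  show "geom_interp u v ((1 - t) *\<^sub>R x + t *\<^sub>R y)
      \<le> (1 - t) * geom_interp u v x + t * geom_interp u v y"
  proof (cases "u = 0 \<or> v = 0")
    case True
    then have "geom_interp u v z = 0" for z by (simp add: geom_interp_eq_0_iff)
    then show ?thesis by simp
  next
    case False
    then have "0 < geom_interp u v z" for z by (simp add: less_le geom_interp_eq_0_iff)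
    then have "geom_interp u v x powr (1 - t) * geom_interp u v y powr t
        \<le> (1 - t) * geom_interp u v x + t * geom_interp u v y"
      using t by (intro Youngs_inequality_0) auto
    then show ?thesis using geom_interp_geom_interp[OF assms, of "1 - t" t x y] by simp
  qed
qed simp

section \<open>Slopes of convex functions and limits of monotone functions\<close>

text \<open>The slope of a chord from \<open>m\<close> increases with its other endpoint, so the
  slope to \<open>a\<close> lies between those to \<open>l\<close> and \<open>r\<close>. The bound
  is free of \<open>a\<close> and can dominate difference quotients under an integral.\<close>

lemma convex_slope_bound:
  fixes f :: "real \<Rightarrow> real"
  assumes f: "convex_on UNIV f" and a: "l < a" "a < r" "a \<noteq> m" and m: "l < m" "m < r"
  shows "\<bar>(f a - f m) / (a - m)\<bar> \<le> \<bar>(f l - f m) / (l - m)\<bar> + \<bar>(f m - f r) / (m - r)\<bar>"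
proof -
  have sym: "(f x - f y) / (x - y) = (f y - f x) / (y - x)" for x y
    by (metis minus_diff_eq minus_divide_divide)
  note sl = convex_on_slope_le[OF f UNIV_I UNIV_I]
  have "(f l - f m) / (l - m) \<le> (f a - f m) / (a - m) \<and> (f a - f m) / (a - m) \<le> (f m - f r) / (m - r)"
  proof (cases "a < m")
    case True
    then show ?thesis
      using sl(2)[of l a m] sl(1)[of a m r] sl(2)[of a m r] a m by linarith
  next
    case False
    then have "m < a" using a by simp
    then show ?thesis
      using sl(1)[of m a r] sl(1)[of l m a] sl(2)[of l m a] a m sym[of a m] by linarith
  qed
  then show ?thesis by linarith
qed

lemma mono_on_tendsto_SUP_at_left:
  fixes f :: "real \<Rightarrow> ereal"
  assumes "mono_on {l<..<r} f" "l < r"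
  shows "(f \<longlongrightarrow> (SUP x\<in>{l<..<r}. f x)) (at_left r)"
proof (rule increasing_tendsto)
  have ev: "eventually (\<lambda>x. x \<in> {z<..<r}) (at_left r)" if "z < r" for z
    by (rule eventually_at_leftI[OF _ that]) simp
  show "\<forall>\<^sub>F x in at_left r. f x \<le> (SUP x\<in>{l<..<r}. f x)"
    using ev[OF assms(2)] by eventually_elim (rule SUP_upper)
  fix y assume "y < (SUP x\<in>{l<..<r}. f x)"
  then obtain z where z: "z \<in> {l<..<r}" "y < f z" by (auto simp: less_SUP_iff)
  then have "z < r" by simp
  from ev[OF this] show "\<forall>\<^sub>F x in at_left r. y < f x"
  proof eventually_elim
    case (elim x)
    then have "f z \<le> f x" using assms(1) z by (intro mono_onD[OF assms(1)]) auto
    then show ?case using z(2) by simp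
  qed
qed

lemma mono_on_tendsto_INF_at_right:
  fixes f :: "real \<Rightarrow> ereal"
  assumes "mono_on {l<..<r} f" "l < r"
  shows "(f \<longlongrightarrow> (INF x\<in>{l<..<r}. f x)) (at_right l)"
proof (rule decreasing_tendsto)
  have ev: "eventually (\<lambda>x. x \<in> {l<..<z}) (at_right l)" if "l < z" for z
    by (rule eventually_at_rightI[OF _ that]) simp
  show "\<forall>\<^sub>F x in at_right l. (INF x\<in>{l<..<r}. f x) \<le> f x"
    using ev[OF assms(2)] by eventually_elim (rule INF_lower)
  fix y assume "(INF x\<in>{l<..<r}. f x) < y"
  then obtain z where z: "z \<in> {l<..<r}" "f z < y" by (auto simp: INF_less_iff)
  then have "l < z" by simp
  from ev[OF this] show "\<forall>\<^sub>F x in at_right l. f x < y"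
  proof eventually_elim
    case (elim x)
    then have "f x \<le> f z" using assms(1) z by (intro mono_onD[OF assms(1)]) auto
    then show ?case using z(2) by simp
  qed
qed

lemma mono_on_tendsto_SUP_at_top:
  fixes f :: "real \<Rightarrow> ereal"
  assumes "mono_on {l<..} f"
  shows "(f \<longlongrightarrow> (SUP x\<in>{l<..}. f x)) at_top"
proof (rule increasing_tendsto)
  show "\<forall>\<^sub>F x in at_top. f x \<le> (SUP x\<in>{l<..}. f x)"
    using eventually_gt_at_top[of l] by eventually_elim (auto intro: SUP_upper)
  fix y assume "y < (SUP x\<in>{l<..}. f x)"
  then obtain z where z: "z > l" "y < f z" by (auto simp: less_SUP_iff)
  from eventually_gt_at_top[of z] show "\<forall>\<^sub>F x in at_top. y < f x"
  proof eventually_elim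
    case (elim x)
    then have "f z \<le> f x" using z by (intro mono_onD[OF assms]) auto
    then show ?case using z(2) by simp
  qed
qed

section \<open>Moments of a pair of real densities\<close>

locale density_pair =
  fixes M :: "'a measure" and p q :: "'a \<Rightarrow> real"
  assumes integrable_p: "integrable M p" and integrable_q: "integrable M q"
    and p_nonneg: "\<And>x. 0 \<le> p x" and q_nonneg: "\<And>x. 0 \<le> q x"
    and integral_p: "(\<integral>x. p x \<partial>M) = 1"
begin

definition moment_fun :: "real \<Rightarrow> 'a \<Rightarrow> real" where
  "moment_fun a x = geom_interp (p x) (q x) a"

text \<open>The Bochner integral defaults to 0 when the integrand is not integrable, so a value is
  meaningful only together with an integrability fact.\<close>

definition moment :: "real \<Rightarrow> real" where
  "moment a = (\<integral>x. moment_fun a x \<partial>M)"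

text \<open>The \<open>ennreal\<close> integral is kept because above order 1 the integrand is
  infinite where \<open>q x = 0 < p x\<close>, whereas \<open>moment_fun\<close> is 0 there.\<close>

definition renyi_div :: "real \<Rightarrow> ereal" where
  "renyi_div a = ereal (1 / (a - 1)) *
     ln_ennreal (\<integral>\<^sup>+x. renyi_integrand a (ennreal (p x)) (ennreal (q x)) \<partial>M)"

lemma measurable_p [measurable]: "p \<in> borel_measurable M"
  and measurable_q [measurable]: "q \<in> borel_measurable M"
  using integrable_p integrable_q by auto

lemma measurable_moment_fun [measurable]: "moment_fun a \<in> borel_measurable M"
  unfolding moment_fun_def geom_interp_def by measurable

lemma moment_fun_nonneg [simp]: "0 \<le> moment_fun a x"
  by (simp add: moment_fun_def)

lemma moment_fun_eq_0_iff: "moment_fun a x = 0 \<longleftrightarrow> p x = 0 \<or> q x = 0"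
  by (simp add: moment_fun_def geom_interp_eq_0_iff)

lemma moment_fun_le: "0 \<le> a \<Longrightarrow> a \<le> c \<Longrightarrow> moment_fun a x \<le> q x + moment_fun c x"
  unfolding moment_fun_def by (rule geom_interp_le[OF p_nonneg q_nonneg])

text \<open>Equality fails exactly where \<open>q x = 0 < p x\<close>, because
  \<open>0 powr 0 = 0\<close>; hence \<open>moment 1\<close> can be below 1.\<close>

lemma moment_fun_1_le: "moment_fun 1 x \<le> p x"
  using p_nonneg[of x] by (simp add: moment_fun_def geom_interp_def powr_def)

lemma integrable_moment_fun_1: "integrable M (moment_fun 1)"
  by (rule Bochner_Integration.integrable_bound[OF integrable_p])
     (use moment_fun_1_le p_nonneg in auto)

lemma integrable_moment_fun:
  assumes "integrable M (moment_fun c)" "0 \<le> a" "a \<le> c"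
  shows "integrable M (moment_fun a)"
proof (rule Bochner_Integration.integrable_bound)
  show "integrable M (\<lambda>x. q x + moment_fun c x)"
    using assms(1) integrable_q by simp
  show "AE x in M. norm (moment_fun a x) \<le> norm (q x + moment_fun c x)"
    using moment_fun_le[OF assms(2,3)] by (auto simp: q_nonneg)
qed measurable

text \<open>The dominating function \<open>q + moment_fun c\<close> serves the orders in [0, c]
  only. At \<open>b = c\<close> this is continuity from the left.\<close>

lemma continuous_moment:
  assumes c: "integrable M (moment_fun c)" and b: "0 \<le> b"
  shows "(moment \<longlongrightarrow> moment b) (at b within {0..c})"
  unfolding moment_def
proof (rule tendsto_integral_within)
  show "integrable M (\<lambda>x. q x + moment_fun c x)"
    using c integrable_q by simp
  show "AE x in M. ((\<lambda>t. moment_fun t x) \<longlongrightarrow> moment_fun b x) (at b within {0..c})"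
    using continuous_geom_interp[OF p_nonneg q_nonneg] by (simp add: moment_fun_def)
qed (use moment_fun_le in auto)

lemma moment_nonneg: "0 \<le> moment a"
  unfolding moment_def by (rule Bochner_Integration.integral_nonneg) simp

lemma moment_eq_0_iff:
  assumes "integrable M (moment_fun a)"
  shows "moment a = 0 \<longleftrightarrow> (AE x in M. p x = 0 \<or> q x = 0)"
  unfolding moment_def by (subst integral_nonneg_eq_0_iff_AE[OF assms]) (auto simp: moment_fun_eq_0_iff)

lemma moment_1_le: "moment 1 \<le> 1"
proof -
  have "moment 1 \<le> (\<integral>x. p x \<partial>M)" unfolding moment_def
    by (intro integral_mono integrable_moment_fun_1 integrable_p moment_fun_1_le)
  then show ?thesis by (simp add: integral_p)
qed

text \<open>Hoelder's inequality between the orders \<open>u\<close> and 1: Young's inequality is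
  applied pointwise after dividing \<open>moment_fun u\<close> by its integral \<open>K\<close>,
  then integrated. \<open>moment_1_le\<close> absorbs the factor of order 1.\<close>

lemma moment_convex_1:
  assumes u: "integrable M (moment_fun u)" "0 < moment u" and s: "0 < s" "s < 1"
    and v: "v = s * u + (1 - s)" "integrable M (moment_fun v)"
  shows "moment v \<le> moment u powr s"
proof -
  define K where "K = moment u"
  have K: "0 < K" using u by (simp add: K_def)
  have "moment v \<le> (\<integral>x. K powr s * (s * (moment_fun u x / K) + (1 - s) * moment_fun 1 x) \<partial>M)"
    unfolding moment_def
  proof (intro integral_mono v(2))
    show "integrable M (\<lambda>x. K powr s * (s * (moment_fun u x / K) + (1 - s) * moment_fun 1 x))"
      using u(1) integrable_moment_fun_1 by simp
    fix x
    show "moment_fun v x \<le> K powr s * (s * (moment_fun u x / K) + (1 - s) * moment_fun 1 x)"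
    proof (cases "p x = 0 \<or> q x = 0")
      case True
      then have "moment_fun z x = 0" for z by (simp add: moment_fun_eq_0_iff)
      then show ?thesis by simp
    next
      case False
      then have pos: "0 < moment_fun z x" for z by (simp add: less_le moment_fun_eq_0_iff)
      have "moment_fun v x = moment_fun u x powr s * moment_fun 1 x powr (1 - s)"
        unfolding moment_fun_def v(1)
        using geom_interp_geom_interp[OF p_nonneg q_nonneg, of s "1 - s" x x u 1] by simp
      also have "\<dots> = K powr s * ((moment_fun u x / K) powr s * moment_fun 1 x powr (1 - s))"
        using K by (simp add: powr_divide)
      also have "\<dots> \<le> K powr s * (s * (moment_fun u x / K) + (1 - s) * moment_fun 1 x)"
        using pos K s by (intro mult_left_mono Youngs_inequality_0) auto
      finally show ?thesis .
    qed
  qed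
  also have "\<dots> = K powr s * (s * (moment u / K) + (1 - s) * moment 1)"
    unfolding moment_def using u(1) integrable_moment_fun_1 by simp
  also have "\<dots> \<le> K powr s * (s * 1 + (1 - s) * 1)"
    using K s moment_1_le by (intro mult_left_mono add_mono) (auto simp: K_def)
  finally show ?thesis by (simp add: K_def)
qed

lemma ln_moment_convex_1:
  assumes "integrable M (moment_fun u)" "0 < moment u" "0 < s" "s < 1"
    "v = s * u + (1 - s)" "integrable M (moment_fun v)" "0 < moment v"
  shows "ln (moment v) \<le> s * ln (moment u)"
proof -
  have "ln (moment v) \<le> ln (moment u powr s)"
    using moment_convex_1[of u s v] assms by (intro ln_mono) auto
  then show ?thesis using assms by (simp add: ln_powr)
qed

section \<open>Closed forms of the divergence\<close>

text \<open>The moment is 0 exactly when the supports are almost disjoint. The logarithm is then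
  minus infinity, and the negative factor \<open>1 / (a - 1)\<close> makes it plus infinity.\<close>

lemma renyi_div_lt_1:
  assumes a: "0 < a" "a < 1"
  shows "renyi_div a = (if AE x in M. p x = 0 \<or> q x = 0 then \<infinity> else ereal (ln (moment a) / (a - 1)))"
proof -
  have int: "integrable M (moment_fun a)"
    using a by (intro integrable_moment_fun[OF integrable_moment_fun_1]) auto
  have "(\<integral>\<^sup>+x. renyi_integrand a (ennreal (p x)) (ennreal (q x)) \<partial>M) = (\<integral>\<^sup>+x. ennreal (moment_fun a x) \<partial>M)"
    using a p_nonneg q_nonneg
    by (intro nn_integral_cong) (simp add: renyi_integrand_def moment_fun_def geom_interp_def)
  also have "\<dots> = ennreal (moment a)"
    unfolding moment_def by (intro nn_integral_eq_integral int) simp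
  finally have "renyi_div a = ereal (1 / (a - 1)) * ln_ennreal (ennreal (moment a))"
    by (simp add: renyi_div_def)
  then show ?thesis using a moment_nonneg[of a] moment_eq_0_iff[OF int]
    by (auto simp: ln_ennreal_def)
qed

text \<open>As \<open>1 / (c - 1)\<close> is positive, the integral is finite, so the integrand is
  finite almost everywhere, which excludes \<open>q x = 0 < p x\<close>. Almost disjoint supports
  would then give \<open>p = 0\<close> almost everywhere, against \<open>integral_p\<close>.\<close>

lemma renyi_div_gt_1_finite:
  assumes c: "1 < c" "renyi_div c < \<infinity>"
  shows "AE x in M. q x = 0 \<longrightarrow> p x = 0" "integrable M (moment_fun c)"
    "\<not> (AE x in M. p x = 0 \<or> q x = 0)"
proof -
  define I where "I = (\<integral>\<^sup>+x. renyi_integrand c (ennreal (p x)) (ennreal (q x)) \<partial>M)"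
  have [measurable]: "(\<lambda>x. renyi_integrand c (ennreal (p x)) (ennreal (q x))) \<in> borel_measurable M"
    unfolding renyi_integrand_def by measurable
  have I: "I \<noteq> \<infinity>"
  proof
    assume "I = \<infinity>"
    then have "renyi_div c = \<infinity>"
      using c by (simp add: renyi_div_def I_def[symmetric] ln_ennreal_def)
    then show False using c by simp
  qed
  then have "AE x in M. renyi_integrand c (ennreal (p x)) (ennreal (q x)) \<noteq> \<infinity>"
    unfolding I_def by (intro nn_integral_PInf_AE) auto
  then show ac: "AE x in M. q x = 0 \<longrightarrow> p x = 0"
    by eventually_elim
       (use c p_nonneg in \<open>auto simp: renyi_integrand_def ennreal_divide_zero split: if_splits\<close>)
  have "(\<integral>\<^sup>+x. ennreal (moment_fun c x) \<partial>M) \<le> I"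
    unfolding I_def
  proof (rule nn_integral_mono)
    fix x
    show "ennreal (moment_fun c x) \<le> renyi_integrand c (ennreal (p x)) (ennreal (q x))"
    proof (cases "q x = 0")
      case False
      have "q x powr (1 - c) = 1 / q x powr (c - 1)"
        using powr_minus_divide[of "q x" "c - 1"] by simp
      then show ?thesis using False c p_nonneg[of x] q_nonneg[of x]
        by (simp add: renyi_integrand_def moment_fun_def geom_interp_def divide_ennreal)
    qed (simp add: moment_fun_def geom_interp_def)
  qed
  then have "(\<integral>\<^sup>+x. ennreal (moment_fun c x) \<partial>M) < \<infinity>" using I by (simp add: le_less_trans less_top)
  then show "integrable M (moment_fun c)" by (intro integrableI_nonneg) auto
  show "\<not> (AE x in M. p x = 0 \<or> q x = 0)"
  proof
    assume "AE x in M. p x = 0 \<or> q x = 0"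
    then have "AE x in M. p x = 0" using ac by eventually_elim auto
    then have "(\<integral>x. p x \<partial>M) = (\<integral>x. 0 \<partial>M)" by (intro integral_cong_AE) auto
    then show False using integral_p by simp
  qed
qed

lemma renyi_div_gt_1:
  assumes "AE x in M. q x = 0 \<longrightarrow> p x = 0" "integrable M (moment_fun a)" "0 < moment a" "1 < a"
  shows "renyi_div a = ereal (ln (moment a) / (a - 1))"
proof -
  have "(\<integral>\<^sup>+x. renyi_integrand a (ennreal (p x)) (ennreal (q x)) \<partial>M) = (\<integral>\<^sup>+x. ennreal (moment_fun a x) \<partial>M)"
  proof (rule nn_integral_cong_AE)
    show "AE x in M. renyi_integrand a (ennreal (p x)) (ennreal (q x)) = ennreal (moment_fun a x)"
      using assms(1)
    proof eventually_elim
      case (elim x)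
      have "q x powr (1 - a) = 1 / q x powr (a - 1)"
        using powr_minus_divide[of "q x" "a - 1"] by simp
      then show ?case using elim assms p_nonneg[of x] q_nonneg[of x]
        by (cases "q x = 0")
           (auto simp: renyi_integrand_def moment_fun_def geom_interp_def divide_ennreal)
    qed
  qed
  also have "\<dots> = ennreal (moment a)"
    unfolding moment_def by (intro nn_integral_eq_integral assms) simp
  finally show ?thesis using assms by (simp add: renyi_div_def ln_ennreal_def)
qed

lemma moment_pos_of_finite:
  assumes "1 < c" "renyi_div c < \<infinity>" "0 \<le> a" "a \<le> c"
  shows "0 < moment a" "integrable M (moment_fun a)"
proof -
  note fin = renyi_div_gt_1_finite[OF assms(1,2)]
  show int: "integrable M (moment_fun a)"
    using assms fin by (intro integrable_moment_fun[OF fin(2)]) auto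
  show "0 < moment a"
    using moment_nonneg[of a] moment_eq_0_iff[OF int] fin(3) by auto
qed

lemma renyi_div_eq_of_finite:
  assumes c: "1 < c" "renyi_div c < \<infinity>" and a: "0 < a" "a \<le> c" "a \<noteq> 1"
  shows "renyi_div a = ereal (ln (moment a) / (a - 1))"
  using renyi_div_gt_1_finite[OF c] moment_pos_of_finite[OF c, of a] a
    renyi_div_gt_1[of a] renyi_div_lt_1[of a] by (cases "a < 1") auto

section \<open>Monotonicity in the order\<close>

lemma mono_renyi_div_lt_1: "mono_on {0<..<1} renyi_div"
proof (rule mono_onI)
  fix a b :: real assume ab: "a \<in> {0<..<1}" "b \<in> {0<..<1}" "a \<le> b"
  show "renyi_div a \<le> renyi_div b"
  proof (cases "(AE x in M. p x = 0 \<or> q x = 0) \<or> a = b")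
    case True
    then show ?thesis using ab by (auto simp: renyi_div_lt_1)
  next
    case False
    have int: "integrable M (moment_fun z)" if "z \<in> {0<..<1}" for z
      using that by (intro integrable_moment_fun[OF integrable_moment_fun_1]) auto
    have pos: "0 < moment z" if "z \<in> {0<..<1}" for z
      using moment_nonneg[of z] moment_eq_0_iff[OF int[OF that]] False by auto
    \<comment> \<open>Solves \<open>b = s * a + (1 - s)\<close>: the order \<open>b\<close> lies
      between \<open>a\<close> and 1. The inequality is reversed at the end because
      \<open>a - 1\<close> and \<open>b - 1\<close> are negative.\<close>
    define s where "s = (1 - b) / (1 - a)"
    have s: "0 < s" "s < 1" using ab False by (auto simp: s_def field_simps)
    have sa: "s * (1 - a) = 1 - b" using ab by (simp add: s_def)
    have "ln (moment b) \<le> s * ln (moment a)"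
      using sa by (intro ln_moment_convex_1 int pos ab s) (simp add: algebra_simps)
    then have "ln (moment b) * (1 - a) \<le> s * ln (moment a) * (1 - a)"
      using ab by (intro mult_right_mono) auto
    also have "\<dots> = ln (moment a) * (1 - b)" by (simp flip: sa)
    finally have "ln (moment a) / (a - 1) \<le> ln (moment b) / (b - 1)"
      using ab by (simp add: field_simps)
    then show ?thesis using ab False by (simp add: renyi_div_lt_1)
  qed
qed

lemma mono_renyi_div_gt_1: "mono_on {1<..} renyi_div"
proof (rule mono_onI)
  fix a b :: real assume ab: "a \<in> {1<..}" "b \<in> {1<..}" "a \<le> b"
  show "renyi_div a \<le> renyi_div b"
  proof (cases "renyi_div b = \<infinity> \<or> a = b")
    case True
    then show ?thesis by auto
  next
    case False
    then have b: "1 < b" "renyi_div b < \<infinity>" using ab by auto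
    \<comment> \<open>Now \<open>a\<close> lies between 1 and \<open>b\<close>, so the roles are
      exchanged: \<open>a = s * b + (1 - s)\<close>.\<close>
    define s where "s = (a - 1) / (b - 1)"
    have s: "0 < s" "s < 1" using ab False by (auto simp: s_def field_simps)
    have sb: "s * (b - 1) = a - 1" using ab by (simp add: s_def)
    have "ln (moment a) \<le> s * ln (moment b)"
      using sb ab by (intro ln_moment_convex_1 moment_pos_of_finite[OF b] s) (auto simp: algebra_simps)
    then have "ln (moment a) * (b - 1) \<le> s * ln (moment b) * (b - 1)"
      using ab by (intro mult_right_mono) auto
    also have "\<dots> = ln (moment b) * (a - 1)" by (simp flip: sb)
    finally have "ln (moment a) / (a - 1) \<le> ln (moment b) / (b - 1)"
      using ab by (simp add: field_simps)
    then show ?thesis using ab by (simp add: renyi_div_eq_of_finite[OF b])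
  qed
qed

section \<open>Continuity at finite orders other than 0 and 1\<close>

lemma continuous_renyi_div_lt_1:
  assumes b: "0 < b" "b < 1"
  shows "(renyi_div \<longlongrightarrow> renyi_div b) (at b)"
proof -
  have ev: "\<forall>\<^sub>F t in at b. t \<in> {0<..<1}"
    using b by (intro eventually_at_in_open') auto
  have at: "at b within {0..1} = at b"
    using b by (intro at_within_interior) (simp add: interior_atLeastAtMost_real)
  show ?thesis
  proof (cases "AE x in M. p x = 0 \<or> q x = 0")
    case True
    have "\<forall>\<^sub>F t in at b. renyi_div b = renyi_div t"
      using ev by eventually_elim (use b True in \<open>simp add: renyi_div_lt_1\<close>)
    then show ?thesis by (rule Lim_transform_eventually[OF tendsto_const])
  next
    case False
    have "integrable M (moment_fun b)"
      using b by (intro integrable_moment_fun[OF integrable_moment_fun_1]) auto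
    then have pos: "moment b \<noteq> 0" using moment_eq_0_iff False by blast
    have "((\<lambda>t. ereal (ln (moment t) / (t - 1))) \<longlongrightarrow> ereal (ln (moment b) / (b - 1))) (at b)"
      using continuous_moment[OF integrable_moment_fun_1, of b] b pos
      by (intro tendsto_intros) (auto simp: at)
    then have "((\<lambda>t. ereal (ln (moment t) / (t - 1))) \<longlongrightarrow> renyi_div b) (at b)"
      using b False by (simp add: renyi_div_lt_1)
    moreover have "\<forall>\<^sub>F t in at b. ereal (ln (moment t) / (t - 1)) = renyi_div t"
      using ev by eventually_elim (use False in \<open>simp add: renyi_div_lt_1\<close>)
    ultimately show ?thesis by (rule Lim_transform_eventually)
  qed
qed

lemma continuous_renyi_div_gt_1:
  assumes b: "1 < b" "renyi_div b < \<infinity>"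
  shows "(renyi_div \<longlongrightarrow> renyi_div b) (at b within {t. 1 < t \<and> renyi_div t < \<infinity>})"
proof -
  \<comment> \<open>One order \<open>c\<close> of finite divergence has to control all relevant
    orders near \<open>b\<close>. If there is one above \<open>b\<close>, it serves; otherwise
    \<open>b\<close> is the largest such order, and \<open>c = b\<close> with approach from the
    left.\<close>
  have "\<exists>c\<ge>b. renyi_div c < \<infinity> \<and> (\<forall>\<^sub>F t in at b within {t. 1 < t \<and> renyi_div t < \<infinity>}. 1 < t \<and> t \<le> c)"
  proof (cases "\<exists>c>b. renyi_div c < \<infinity>")
    case True
    then obtain c where c: "c > b" "renyi_div c < \<infinity>" by blast
    then have "\<forall>\<^sub>F t in at b within {t. 1 < t \<and> renyi_div t < \<infinity>}. t \<in> {1<..<c}"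
      using b by (intro eventually_at_in_open'[THEN filter_leD[OF at_le[OF subset_UNIV]]]) auto
    then show ?thesis using c by (intro exI[of _ c]) (auto elim: eventually_mono)
  next
    case False
    then have "t \<le> b" if "renyi_div t < \<infinity>" for t using that by (meson not_le)
    then show ?thesis using b by (intro exI[of _ b]) (auto simp: eventually_at_filter intro!: always_eventually)
  qed
  then obtain c where c: "c \<ge> b" "renyi_div c < \<infinity>"
    and ev: "\<forall>\<^sub>F t in at b within {t. 1 < t \<and> renyi_div t < \<infinity>}. 1 < t \<and> t \<le> c" by blast
  have c1: "1 < c" using b c by simp
  note cc = c1 c(2)
  let ?F = "at b within {t. 1 < t \<and> renyi_div t < \<infinity>}"
  have le: "?F \<le> at b within {0..c}"
    unfolding le_filter_def
  proof (intro allI impI)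
    fix R assume "eventually R (at b within {0..c})"
    then have "\<forall>\<^sub>F t in nhds b. t \<noteq> b \<longrightarrow> t \<in> {0..c} \<longrightarrow> R t" by (simp add: eventually_at_filter)
    moreover have "\<forall>\<^sub>F t in nhds b. t \<noteq> b \<longrightarrow> t \<in> {t. 1 < t \<and> renyi_div t < \<infinity>} \<longrightarrow> 1 < t \<and> t \<le> c"
      using ev by (simp add: eventually_at_filter)
    ultimately show "eventually R ?F"
      unfolding eventually_at_filter by eventually_elim auto
  qed
  have "(moment \<longlongrightarrow> moment b) ?F"
    using b by (intro filterlim_mono[OF continuous_moment order_refl le] renyi_div_gt_1_finite[OF cc]) auto
  moreover have "moment b \<noteq> 0" using moment_pos_of_finite(1)[OF cc, of b] b c by simp
  ultimately have "((\<lambda>t. ereal (ln (moment t) / (t - 1))) \<longlongrightarrow> ereal (ln (moment b) / (b - 1))) ?F"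
    using b by (intro tendsto_intros) auto
  then have "((\<lambda>t. ereal (ln (moment t) / (t - 1))) \<longlongrightarrow> renyi_div b) ?F"
    using b c by (simp add: renyi_div_eq_of_finite[OF cc])
  moreover have "\<forall>\<^sub>F t in ?F. ereal (ln (moment t) / (t - 1)) = renyi_div t"
    using ev by eventually_elim (auto simp: renyi_div_eq_of_finite[OF cc])
  ultimately show ?thesis by (rule Lim_transform_eventually)
qed

section \<open>The two-sided limit at order 1\<close>

text \<open>The limit may stay unnamed: uniqueness of the left limit identifies it later.\<close>

lemma renyi_div_tendsto_1:
  assumes c: "1 < c" "renyi_div c < \<infinity>"
  shows "\<exists>L. (renyi_div \<longlongrightarrow> L) (at 1)"
proof -
  note fin = renyi_div_gt_1_finite[OF c]
  \<comment> \<open>The left anchor for the slope bound; any order in (0, 1) would do. The right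
    anchor is \<open>c\<close>.\<close>
  define h where "h = (1/2 :: real)"
  define slope where "slope a x = (moment_fun a x - moment_fun 1 x) / (a - 1)" for a x
  have int: "integrable M (moment_fun a)" if "a \<in> {h<..<c}" for a
    using that c by (intro moment_pos_of_finite[OF c]) (auto simp: h_def)
  have int1: "integrable M (moment_fun 1)" by (rule integrable_moment_fun_1)
  have inth: "integrable M (moment_fun h)"
    using c by (intro moment_pos_of_finite[OF c]) (auto simp: h_def)
  have at: "at 1 within {h<..<c} = at 1"
    using c by (intro at_within_open) (auto simp: h_def)
  have ev: "\<forall>\<^sub>F t in at 1. t \<in> {h<..<c} - {1}"
    using c by (intro eventually_at_in_open) (auto simp: h_def)
  have moment1: "moment 1 = 1"
  proof -
    have "moment 1 = (\<integral>x. p x \<partial>M)" unfolding moment_def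
    proof (rule integral_cong_AE)
      show "AE x in M. moment_fun 1 x = p x"
        using fin(1) by eventually_elim (use p_nonneg in \<open>auto simp: moment_fun_def geom_interp_def\<close>)
    qed auto
    then show ?thesis using integral_p by simp
  qed
  \<comment> \<open>Since \<open>moment_fun 1\<close> agrees with \<open>p\<close> almost
    everywhere, this is the Kullback-Leibler divergence.\<close>
  define L where "L = (\<integral>x. moment_fun 1 x * ln (p x / q x) \<partial>M)"
  have "((\<lambda>a. \<integral>x. slope a x \<partial>M) \<longlongrightarrow> L) (at 1 within {h<..<c})"
    unfolding L_def
  proof (rule tendsto_integral_within)
    show "integrable M (\<lambda>x. \<bar>(moment_fun h x - moment_fun 1 x) / (h - 1)\<bar>
        + \<bar>(moment_fun 1 x - moment_fun c x) / (1 - c)\<bar>)"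
      using int1 inth fin(2) by simp
    show "AE x in M. ((\<lambda>a. slope a x) \<longlongrightarrow> moment_fun 1 x * ln (p x / q x)) (at 1 within {h<..<c})"
      using geom_interp_deriv[OF p_nonneg q_nonneg]
      by (simp add: slope_def moment_fun_def has_field_derivative_iff)
    fix a x assume "a \<in> {h<..<c}" "a \<noteq> 1"
    then show "norm (slope a x) \<le> \<bar>(moment_fun h x - moment_fun 1 x) / (h - 1)\<bar>
        + \<bar>(moment_fun 1 x - moment_fun c x) / (1 - c)\<bar>"
      unfolding slope_def moment_fun_def real_norm_def using c
      by (intro convex_slope_bound convex_on_geom_interp p_nonneg q_nonneg) (auto simp: h_def)
  qed (auto simp: slope_def)
  moreover have "\<forall>\<^sub>F a in at 1. (\<integral>x. slope a x \<partial>M) = (moment a - moment 1) / (a - 1)"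
    using ev by eventually_elim (use int int1 in \<open>simp add: slope_def moment_def\<close>)
  ultimately have "((\<lambda>a. (moment a - moment 1) / (a - 1)) \<longlongrightarrow> L) (at 1)"
    unfolding at by (rule Lim_transform_eventually)
  then have "(moment has_real_derivative L) (at 1)"
    by (simp add: has_field_derivative_iff)
  \<comment> \<open>Because \<open>moment 1 = 1\<close>, the chain rule contributes the factor 1,
    and \<open>ln (moment 1) = 0\<close> turns the difference quotient into
    \<open>ln (moment a) / (a - 1)\<close>.\<close>
  then have "((\<lambda>a. ln (moment a)) has_real_derivative L) (at 1)"
    using DERIV_chain2[OF DERIV_ln_divide, of moment 1 L UNIV] by (simp add: moment1)
  then have "((\<lambda>a. ln (moment a) / (a - 1)) \<longlongrightarrow> L) (at 1)"
    by (simp add: has_field_derivative_iff moment1)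
  then have "((\<lambda>a. ereal (ln (moment a) / (a - 1))) \<longlongrightarrow> ereal L) (at 1)" by simp
  moreover have "\<forall>\<^sub>F a in at 1. ereal (ln (moment a) / (a - 1)) = renyi_div a"
    using ev by eventually_elim (auto simp: h_def renyi_div_eq_of_finite[OF c])
  ultimately show ?thesis by (blast intro: Lim_transform_eventually)
qed

end

section \<open>From densities to measures, and the theorem\<close>

text \<open>The derivatives are finite almost everywhere, so \<open>enn2real\<close> preserves their
  integrals, which are the total masses.\<close>

lemma density_pair_RN_deriv:
  assumes P: "prob_space P" and Q: "prob_space Q" and sets: "sets Q = sets P"
  shows "density_pair (sum_measure P Q)
    (\<lambda>x. enn2real (RN_deriv (sum_measure P Q) P x)) (\<lambda>x. enn2real (RN_deriv (sum_measure P Q) Q x))"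
proof -
  interpret P: prob_space P by fact
  interpret Q: prob_space Q by fact
  define N where "N = sum_measure P Q"
  interpret N: finite_measure N
    unfolding N_def by (intro finite_measure_sum_measure P.finite_measure_axioms Q.finite_measure_axioms sets)
  have dens: "(\<integral>\<^sup>+x. ennreal (enn2real (RN_deriv N R x)) \<partial>N) = ennreal 1"
    if R: "prob_space R" "absolutely_continuous N R" "sets R = sets N" for R
  proof -
    interpret R: prob_space R by fact
    have "AE x in N. RN_deriv N R x \<noteq> \<infinity>"
      by (intro N.RN_deriv_finite R R.sigma_finite_measure_axioms)
    then have "(\<integral>\<^sup>+x. ennreal (enn2real (RN_deriv N R x)) \<partial>N) = (\<integral>\<^sup>+x. RN_deriv N R x \<partial>N)"
      by (intro nn_integral_cong_AE) (auto simp: less_top)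
    also have "\<dots> = emeasure (density N (RN_deriv N R)) (space N)"
      by (subst emeasure_density) (auto intro!: nn_integral_cong)
    also have "\<dots> = 1"
      using R sets_eq_imp_space_eq[OF R(3)] by (simp add: N.density_RN_deriv R.emeasure_space_1[symmetric])
    finally show ?thesis by simp
  qed
  note ac = absolutely_continuous_sum_measure[OF sets, folded N_def]
  have dP: "(\<integral>\<^sup>+x. ennreal (enn2real (RN_deriv N P x)) \<partial>N) = ennreal 1"
    using ac by (intro dens P) (simp_all add: N_def)
  have dQ: "(\<integral>\<^sup>+x. ennreal (enn2real (RN_deriv N Q x)) \<partial>N) = ennreal 1"
    using ac sets by (intro dens Q) (simp_all add: N_def)
  show ?thesis unfolding N_def[symmetric]
  proof
    show "integrable N (\<lambda>x. enn2real (RN_deriv N P x))"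
      by (rule integrableI_nn_integral_finite[OF _ _ dP]) auto
    show "integrable N (\<lambda>x. enn2real (RN_deriv N Q x))"
      by (rule integrableI_nn_integral_finite[OF _ _ dQ]) auto
    show "(\<integral>x. enn2real (RN_deriv N P x) \<partial>N) = 1"
      using dP by (subst integral_eq_nn_integral) auto
  qed auto
qed

theorem theorem7:
  fixes P Q :: "'a measure"
  assumes "prob_space P" and "prob_space Q" and "sets Q = sets P"
  shows "continuous_on {\<alpha>::ereal. 0 \<le> \<alpha> \<and> (\<alpha> \<le> 1 \<or> renyi_divergence \<alpha> P Q < \<infinity>)}
           (\<lambda>\<alpha>. renyi_divergence \<alpha> P Q)"
proof -
  define A where "A = {\<alpha>::ereal. 0 \<le> \<alpha> \<and> (\<alpha> \<le> 1 \<or> renyi_divergence \<alpha> P Q < \<infinity>)}"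
  interpret density_pair "sum_measure P Q"
    "\<lambda>x. enn2real (RN_deriv (sum_measure P Q) P x)" "\<lambda>x. enn2real (RN_deriv (sum_measure P Q) Q x)"
    using assms by (rule density_pair_RN_deriv)
  \<comment> \<open>\<open>renyi_integrand\<close> applies \<open>enn2real\<close> itself, so making
    the densities real beforehand changes nothing.\<close>
  have "enn2real (ennreal (enn2real z)) = enn2real z" for z
    by (rule enn2real_ennreal) simp
  then have simple: "renyi_divergence_simple a P Q = renyi_div a" for a
    by (simp only: renyi_divergence_simple_def renyi_integral_def renyi_div_def renyi_integrand_def)
  have D0: "renyi_divergence 0 P Q = Lim (at_right 0) renyi_div"
    and D1: "renyi_divergence 1 P Q = Lim (at_left 1) renyi_div"
    and Dinf: "renyi_divergence \<infinity> P Q = Lim at_top renyi_div"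
    by (simp_all add: renyi_divergence_def simple)
  have D: "renyi_divergence (ereal a) P Q = renyi_div a" if "a \<noteq> 0" "a \<noteq> 1" for a
    using that by (simp add: renyi_divergence_def simple zero_ereal_def one_ereal_def)
  \<comment> \<open>\<open>Lim\<close> is a definite description, informative only once a limit
    exists; monotonicity supplies it here and in the next two facts.\<close>
  have lim0: "(renyi_div \<longlongrightarrow> renyi_divergence 0 P Q) (at_right 0)"
    using mono_on_tendsto_INF_at_right[OF mono_renyi_div_lt_1] tendsto_Lim[OF trivial_limit_at_right_real]
    unfolding D0 by fastforce
  have lim1: "(renyi_div \<longlongrightarrow> renyi_divergence 1 P Q) (at_left 1)"
    using mono_on_tendsto_SUP_at_left[OF mono_renyi_div_lt_1] tendsto_Lim[OF trivial_limit_at_left_real]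
    unfolding D1 by fastforce
  have liminf: "(renyi_div \<longlongrightarrow> renyi_divergence \<infinity> P Q) at_top"
    using mono_on_tendsto_SUP_at_top[OF mono_renyi_div_gt_1] tendsto_Lim[OF trivial_limit_at_top_linorder]
    unfolding Dinf by fastforce
  \<comment> \<open>\<open>renyi_div\<close> represents the divergence except at orders 0 and 1, so
    nearby orders other than \<open>a\<close> must avoid these two.\<close>
  have transfer: "((\<lambda>\<alpha>. renyi_divergence \<alpha> P Q) \<longlongrightarrow> l) (at (ereal a) within A)"
    if lim: "(renyi_div \<longlongrightarrow> l) (at a within S)"
      and ev: "\<forall>\<^sub>F t in nhds a. t \<noteq> a \<longrightarrow> ereal t \<in> A \<longrightarrow> t \<in> S \<and> t \<noteq> 0 \<and> t \<noteq> 1" for l a S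
  proof (rule tendsto_ereal_within)
    show "((\<lambda>t. renyi_divergence (ereal t) P Q) \<longlongrightarrow> l) (at a within {t. ereal t \<in> A})"
      unfolding tendsto_def eventually_at_filter
    proof (intro allI impI)
      fix V assume "open V" "l \<in> V"
      then have "\<forall>\<^sub>F t in nhds a. t \<noteq> a \<longrightarrow> t \<in> S \<longrightarrow> renyi_div t \<in> V"
        using lim by (simp add: tendsto_def eventually_at_filter)
      with ev show "\<forall>\<^sub>F t in nhds a. t \<noteq> a \<longrightarrow> t \<in> {t. ereal t \<in> A} \<longrightarrow> renyi_divergence (ereal t) P Q \<in> V"
        by eventually_elim (auto simp: D)
    qed
  qed
  have in_A: "0 \<le> t \<and> (t \<le> 1 \<or> renyi_div t < \<infinity>)" if "ereal t \<in> A" for t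
    using that D[of t] by (cases "t = 0 \<or> t = 1") (auto simp: A_def)
  have "((\<lambda>\<alpha>. renyi_divergence \<alpha> P Q) \<longlongrightarrow> renyi_divergence \<alpha> P Q) (at \<alpha> within A)" if \<alpha>: "\<alpha> \<in> A" for \<alpha>
  proof (cases \<alpha>)
    case MInf
    then show ?thesis using \<alpha> by (simp add: A_def)
  next
    case PInf
    \<comment> \<open>Punctured neighbourhoods of infinity are images of those of
      \<open>at_top\<close>, so continuity there is the defining limit.\<close>
    have "((\<lambda>\<alpha>. renyi_divergence \<alpha> P Q) \<longlongrightarrow> renyi_divergence \<infinity> P Q) (filtermap ereal at_top)"
      unfolding filterlim_filtermap
    proof (rule Lim_transform_eventually[OF liminf])
      show "\<forall>\<^sub>F t in at_top. renyi_div t = renyi_divergence (ereal t) P Q"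
        using eventually_gt_at_top[of 1] by eventually_elim (auto simp: D)
    qed
    then have "((\<lambda>\<alpha>. renyi_divergence \<alpha> P Q) \<longlongrightarrow> renyi_divergence \<infinity> P Q) (at \<infinity>)"
      unfolding at_infty_ereal_eq_at_top .
    then show ?thesis using PInf by (auto intro: tendsto_within_subset)
  next
    case (real b)
    have lt: "\<forall>\<^sub>F t in nhds b. t < c" if "b < c" for c
      using that by (rule order_tendstoD(2)[OF filterlim_ident])
    have gt: "\<forall>\<^sub>F t in nhds b. c < t" if "c < b" for c
      using that by (rule order_tendstoD(1)[OF filterlim_ident])
    note bA = in_A[OF \<alpha>[unfolded real]]
    consider "b = 0" | "0 < b" "b < 1" | "b = 1" | "1 < b" using bA by linarith
    then show ?thesis unfolding real
    proof cases
      case 1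
      have "\<forall>\<^sub>F t in nhds b. t \<noteq> b \<longrightarrow> ereal t \<in> A \<longrightarrow> t \<in> {0<..} \<and> t \<noteq> 0 \<and> t \<noteq> 1"
        using lt[of 1] 1 by (auto elim!: eventually_mono dest: in_A)
      then show "((\<lambda>\<alpha>. renyi_divergence \<alpha> P Q) \<longlongrightarrow> renyi_divergence (ereal b) P Q) (at (ereal b) within A)"
        using lim0 1 by (intro transfer) (auto simp: zero_ereal_def)
    next
      case 2
      have "\<forall>\<^sub>F t in nhds b. t \<noteq> b \<longrightarrow> ereal t \<in> A \<longrightarrow> t \<in> UNIV \<and> t \<noteq> 0 \<and> t \<noteq> 1"
        using lt[OF 2(2)] gt[OF 2(1)] by eventually_elim auto
      then show "((\<lambda>\<alpha>. renyi_divergence \<alpha> P Q) \<longlongrightarrow> renyi_divergence (ereal b) P Q) (at (ereal b) within A)"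
        using continuous_renyi_div_lt_1[OF 2] 2 by (intro transfer) (auto simp: D)
    next
      case 3
      show "((\<lambda>\<alpha>. renyi_divergence \<alpha> P Q) \<longlongrightarrow> renyi_divergence (ereal b) P Q) (at (ereal b) within A)"
      \<comment> \<open>Either a two-sided limit exists and agrees with the defining left limit, or
        no finite order above 1 belongs to \<open>A\<close> and the left limit suffices.\<close>
      proof (cases "\<exists>c>1. renyi_div c < \<infinity>")
        case True
        then obtain L where L: "(renyi_div \<longlongrightarrow> L) (at 1)" using renyi_div_tendsto_1 by blast
        then have "(renyi_div \<longlongrightarrow> L) (at_left 1)" by (auto intro: tendsto_within_subset)
        then have eq: "L = renyi_divergence 1 P Q"
          by (rule tendsto_unique[OF trivial_limit_at_left_real _ lim1])
        have "\<forall>\<^sub>F t in nhds b. t \<noteq> b \<longrightarrow> ereal t \<in> A \<longrightarrow> t \<in> UNIV \<and> t \<noteq> 0 \<and> t \<noteq> 1"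
          using gt[of 0] 3 by (auto elim!: eventually_mono)
        then show ?thesis
          using L eq 3 by (intro transfer) (auto simp: one_ereal_def)
      next
        case False
        have "t \<le> 1" if "renyi_div t < \<infinity>" for t using that False by (meson not_le)
        then have "\<forall>\<^sub>F t in nhds b. t \<noteq> b \<longrightarrow> ereal t \<in> A \<longrightarrow> t \<in> {..<1} \<and> t \<noteq> 0 \<and> t \<noteq> 1"
          using gt[of 0] 3 by (fastforce elim!: eventually_mono dest!: in_A)
        then show ?thesis
          using lim1 3 by (intro transfer) (auto simp: one_ereal_def)
      qed
    next
      case 4
      have "\<forall>\<^sub>F t in nhds b. t \<noteq> b \<longrightarrow> ereal t \<in> A \<longrightarrow>
          t \<in> {t. 1 < t \<and> renyi_div t < \<infinity>} \<and> t \<noteq> 0 \<and> t \<noteq> 1"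
        using gt[OF 4] by eventually_elim (auto dest: in_A)
      then show "((\<lambda>\<alpha>. renyi_divergence \<alpha> P Q) \<longlongrightarrow> renyi_divergence (ereal b) P Q) (at (ereal b) within A)"
        using continuous_renyi_div_gt_1[OF 4] bA 4 by (intro transfer) (auto simp: D)
    qed
  qed
  then show ?thesis unfolding A_def[symmetric] continuous_on_def by blast
qed

end
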